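(* Let $X$ be a Banach space with the Daugavet property and let $F\in\mathcal{F}_{2,2}\cup\mathcal{F}_{3,2}$ (so that $F^*\in\mathcal{F}_{2,2}\cup\mathcal{F}_{2,3}$). Let $c_1=(1,\hat{x}_1)$, $c_2=(\hat{x}_2,1)$, where $\hat{x}_1=\max\{y:(1,y)\in S_{F^*}^+\}$ and $\hat{x}_2=\max\{x:(x,1)\in S_{F^*}^+\}$ (so that $[c_1,c_2]\subset S_{F^*}^+$), and let $(f_1,f_2)\in S_{F}^+$ be such that the line in $F^*$ containing the segment $[c_1,c_2]$ has the equation $f_1a_1+f_2a_2=1$. Then the operator $G:X\to X\oplus_F X$, $Gx=(f_1x,f_2x)$, is a Daugavet center.
   Context: All Banach spaces are real and different from $\{0\}$. A nonzero continuous linear operator $G:X\to Y$ between Banach spaces is a Daugavet center if every (bounded) rank-1 operator $T:X\to Y$ satisfies $\|G+T\|=\|G\|+\|T\|$. $X$ has the Daugavet property if the identity operator $\mathrm{Id}:X\to X$ is a Daugavet center. A two-dimensional lattice is a space $F=(\mathbb{R}^2,\|\cdot\|)$, where the norm satisfies $\|(1,0)\|=\|(0,1)\|=1$ and $\|(a_1,a_2)\|=\|(|a_1|,|a_2|)\|$ for all $(a_1,a_2)$, ordered coordinatewise. Its dual $F^*$ is $\mathbb{R}^2$ with $\|(f_1,f_2)\|_{F^*}=\max_{(a_1,a_2)\in B_F}|f_1a_1+f_2a_2|$, where $B_F$ is the closed unit ball; $F^*$ is again a two-dimensional lattice and $F^{**}=F$. $S_F^+=\{a\in F:\|a\|=1,\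 a\ge 0\}$, and similarly $S_{F^*}^+$. For Banach spaces $X_1,X_2$, $X_1\oplus_F X_2$ is the space of pairs $(x_1,x_2)$, $x_i\in X_i$, with norm $\|(x_1,x_2)\|=\|(\|x_1\|,\|x_2\|)\|_F$. We say $S_F^+$ is a polygon with $n$ edges if it is a polygonal arc from $(1,0)$ to $(0,1)$ consisting of exactly $n$ edges (maximal nondegenerate line segments). For a two-dimensional lattice $F$ such that $S_F^+$ is a polygon with $n$ edges, let $p_1=\max\{y:(1,y)\in S_F^+\}$, $p_2=\max\{x:(x,1)\in S_F^+\}$; then $F\in\mathcal{F}_{n-1,n}$ if $p_1>0$ and $p_2>0$; $F\in\mathcal{F}_{n,n}$ if exactly one of $p_1,p_2$ equals zero; $F\in\mathcal{F}_{n+1,n}$ if $p_1=p_2=0$. Thus $\mathcal{F}_{2,2}\cup\mathcal{F}_{3,2}$ consists of those $F$ for which $S_F^+$ has exactly two edges and at least one of $p_1,p_2$ is zero. *)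

theory Defs
  imports "HOL-Analysis.Analysis"
begin

text \<open>
  The norm of \<open>X \<oplus>\<^sub>F Y\<close> depends on the value \<open>F\<close>, so it cannot be a type class norm on the
  product type. Spaces are therefore given by a real vector space type together with a norm
  function; for the type class norm, the notions below are the library ones (see the
  lemmas at the end).
\<close>

definition is_norm :: "('a::real_vector \<Rightarrow> real) \<Rightarrow> bool" where
  "is_norm N \<longleftrightarrow>
     (\<forall>x. N x \<ge> 0) \<and> (\<forall>x. N x = 0 \<longleftrightarrow> x = 0) \<and>
     (\<forall>r x. N (r *\<^sub>R x) = \<bar>r\<bar> * N x) \<and> (\<forall>x y. N (x + y) \<le> N x + N y)"

definition banach_norm :: "('a::real_vector \<Rightarrow> real) \<Rightarrow> bool" where
  "banach_norm N \<longleftrightarrow> is_norm N \<and> Metric_space.mcomplete UNIV (\<lambda>x y. N (x - y))"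

definition bounded_linear_wrt ::
    "('a::real_vector \<Rightarrow> real) \<Rightarrow> ('b::real_vector \<Rightarrow> real) \<Rightarrow> ('a \<Rightarrow> 'b) \<Rightarrow> bool" where
  "bounded_linear_wrt NX NY T \<longleftrightarrow> linear T \<and> (\<exists>K. \<forall>x. NY (T x) \<le> NX x * K)"

definition op_norm ::
    "('a::real_vector \<Rightarrow> real) \<Rightarrow> ('b::real_vector \<Rightarrow> real) \<Rightarrow> ('a \<Rightarrow> 'b) \<Rightarrow> real" where
  "op_norm NX NY T = (SUP x. NY (T x) / NX x)"

definition rank_one :: "('a::real_vector \<Rightarrow> 'b::real_vector) \<Rightarrow> bool" where
  "rank_one T \<longleftrightarrow> dim (range T) = 1"

definition daugavet_center ::
    "('a::real_vector \<Rightarrow> real) \<Rightarrow> ('b::real_vector \<Rightarrow> real) \<Rightarrow> ('a \<Rightarrow> 'b) \<Rightarrow> bool" where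
  "daugavet_center NX NY G \<longleftrightarrow>
     banach_norm NX \<and> banach_norm NY \<and>
     bounded_linear_wrt NX NY G \<and> G \<noteq> (\<lambda>x. 0) \<and>
     (\<forall>T. bounded_linear_wrt NX NY T \<and> rank_one T \<longrightarrow>
        op_norm NX NY (\<lambda>x. G x + T x) = op_norm NX NY G + op_norm NX NY T)"

definition daugavet_property :: "('a::real_vector \<Rightarrow> real) \<Rightarrow> bool" where
  "daugavet_property N \<longleftrightarrow> daugavet_center N N id"

definition two_dim_lattice :: "(real \<times> real \<Rightarrow> real) \<Rightarrow> bool" where
  "two_dim_lattice F \<longleftrightarrow>
     is_norm F \<and> F (1, 0) = 1 \<and> F (0, 1) = 1 \<and> (\<forall>a1 a2. F (a1, a2) = F (\<bar>a1\<bar>, \<bar>a2\<bar>))"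

definition dual_lattice :: "(real \<times> real \<Rightarrow> real) \<Rightarrow> real \<times> real \<Rightarrow> real" where
  "dual_lattice F = (\<lambda>(f1, f2). SUP (a1, a2)\<in>{a. F a \<le> 1}. \<bar>f1 * a1 + f2 * a2\<bar>)"

definition pos_sphere :: "(real \<times> real \<Rightarrow> real) \<Rightarrow> (real \<times> real) set" where
  "pos_sphere F = {(a1, a2). F (a1, a2) = 1 \<and> a1 \<ge> 0 \<and> a2 \<ge> 0}"

definition lattice_sum ::
    "(real \<times> real \<Rightarrow> real) \<Rightarrow> ('a \<Rightarrow> real) \<Rightarrow> ('b \<Rightarrow> real) \<Rightarrow> 'a \<times> 'b \<Rightarrow> real" where
  "lattice_sum F N1 N2 = (\<lambda>(x1, x2). F (N1 x1, N2 x2))"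

definition maximal_segment :: "'a::real_vector set \<Rightarrow> 'a set \<Rightarrow> bool" where
  "maximal_segment S E \<longleftrightarrow>
     (\<exists>u w. u \<noteq> w \<and> E = closed_segment u w) \<and> E \<subseteq> S \<and>
     (\<forall>u w. E \<subseteq> closed_segment u w \<and> closed_segment u w \<subseteq> S \<longrightarrow> closed_segment u w = E)"

definition polygonal_arc :: "(real \<times> real) set \<Rightarrow> nat \<Rightarrow> bool" where
  "polygonal_arc S n \<longleftrightarrow>
     (\<exists>v :: nat \<Rightarrow> real \<times> real. v 0 = (1, 0) \<and> v n = (0, 1) \<and>
        S = (\<Union>i<n. closed_segment (v i) (v (Suc i))) \<and>
        (\<forall>i<n. v i \<noteq> v (Suc i) \<and> maximal_segment S (closed_segment (v i) (v (Suc i)))) \<and>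
        (\<forall>i j. i < j \<and> j < n \<longrightarrow>
           closed_segment (v i) (v (Suc i)) \<inter> closed_segment (v j) (v (Suc j)) =
             (if j = Suc i then {v j} else {})))"

definition p1 :: "(real \<times> real \<Rightarrow> real) \<Rightarrow> real" where
  "p1 F = (GREATEST y. (1, y) \<in> pos_sphere F)"

definition p2 :: "(real \<times> real \<Rightarrow> real) \<Rightarrow> real" where
  "p2 F = (GREATEST x. (x, 1) \<in> pos_sphere F)"

definition polygonal_lattices :: "nat \<Rightarrow> nat \<Rightarrow> (real \<times> real \<Rightarrow> real) set" where
  "polygonal_lattices m n =
     {F. two_dim_lattice F \<and> polygonal_arc (pos_sphere F) n \<and>
         (p1 F > 0 \<and> p2 F > 0 \<and> m + 1 = n \<or>
          (p1 F = 0 \<longleftrightarrow> p2 F \<noteq> 0) \<and> m = n \<or>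
          p1 F = 0 \<and> p2 F = 0 \<and> m = n + 1)}"

lemma bounded_linear_wrt_norm: "bounded_linear_wrt norm norm T \<longleftrightarrow> bounded_linear T"
  unfolding bounded_linear_wrt_def bounded_linear_def bounded_linear_axioms_def by simp

lemma op_norm_norm: "op_norm norm norm T = onorm T"
  unfolding op_norm_def onorm_def ..

lemma is_norm_norm: "is_norm (norm :: 'a::real_normed_vector \<Rightarrow> real)"
  unfolding is_norm_def by (auto intro: norm_triangle_ineq)

lemma banach_normI:
  assumes N: "is_norm N"
    and conv: "\<And>\<sigma>::nat \<Rightarrow> _. (\<forall>e>0. \<exists>M. \<forall>n\<ge>M. \<forall>m\<ge>M. N (\<sigma> n - \<sigma> m) < e) \<Longrightarrow>
                  \<exists>l. (\<lambda>n. N (\<sigma> n - l)) \<longlonglongrightarrow> 0"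
  shows "banach_norm N"
proof -
  have sym: "N (x - y) = N (y - x)" for x y
  proof -
    have "N ((-1) *\<^sub>R (y - x)) = \<bar>-1\<bar> * N (y - x)"
      using N unfolding is_norm_def by blast
    then show ?thesis by simp
  qed
  have tri: "N (x - z) \<le> N (x - y) + N (y - z)" for x y z
  proof -
    have "N ((x - y) + (y - z)) \<le> N (x - y) + N (y - z)"
      using N unfolding is_norm_def by blast
    then show ?thesis by simp
  qed
  interpret M: Metric_space UNIV "\<lambda>x y. N (x - y)"
  proof
    fix x y z
    show "0 \<le> N (x - y)" "(N (x - y) = 0) = (x = y)"
      using N unfolding is_norm_def by simp_all
    show "N (x - y) = N (y - x)" by (rule sym)
    show "N (x - z) \<le> N (x - y) + N (y - z)" by (rule tri)
  qed
  have "M.mcomplete"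
    unfolding M.mcomplete_def
  proof (intro allI impI)
    fix \<sigma> assume "M.MCauchy \<sigma>"
    then have "\<forall>e>0. \<exists>M. \<forall>n\<ge>M. \<forall>m\<ge>M. N (\<sigma> n - \<sigma> m) < e"
      unfolding M.MCauchy_def by meson
    from conv[OF this] obtain l where "(\<lambda>n. N (\<sigma> n - l)) \<longlonglongrightarrow> 0" by blast
    then show "\<exists>l. limitin M.mtopology \<sigma> l sequentially"
      by (intro exI[of _ l]) (simp add: M.limitin_metric_dist_null)
  qed
  with N show ?thesis unfolding banach_norm_def by blast
qed

lemma banach_norm_norm: "banach_norm (norm :: 'a::banach \<Rightarrow> real)"
proof (rule banach_normI[OF is_norm_norm])
  fix \<sigma> :: "nat \<Rightarrow> 'a"
  assume "\<forall>e>0. \<exists>M. \<forall>n\<ge>M. \<forall>m\<ge>M. norm (\<sigma> n - \<sigma> m) < e"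
  then have "Cauchy \<sigma>" unfolding Cauchy_def dist_norm by blast
  then obtain l where "\<sigma> \<longlonglongrightarrow> l" using Cauchy_convergent convergent_def by blast
  then show "\<exists>l. (\<lambda>n. norm (\<sigma> n - l)) \<longlonglongrightarrow> 0"
    by (metis LIM_zero tendsto_norm_zero)
qed

lemma two_dim_lattice_bounds:
  assumes "two_dim_lattice F"
  shows "\<bar>a\<bar> \<le> F (a, b)" "\<bar>b\<bar> \<le> F (a, b)" "F (a, b) \<le> \<bar>a\<bar> + \<bar>b\<bar>"
proof -
  have tri: "F (x + y) \<le> F x + F y" and hom: "F (r *\<^sub>R x) = \<bar>r\<bar> * F x" for x y r
    using assms unfolding two_dim_lattice_def is_norm_def by blast+
  have e: "F (a, 0) = \<bar>a\<bar>" "F (0, a) = \<bar>a\<bar>" for a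
    using hom[of a "(1, 0)"] hom[of a "(0, 1)"] assms by (auto simp: two_dim_lattice_def)
  have s: "F (a, -b) = F (a, b)" "F (-a, b) = F (a, b)" for a b
    using assms unfolding two_dim_lattice_def by (metis abs_minus_cancel)+
  show "\<bar>a\<bar> \<le> F (a, b)"
    using tri[of "(a, b)" "(a, -b)"] e(1)[of "a + a"] s by simp
  show "\<bar>b\<bar> \<le> F (a, b)"
    using tri[of "(a, b)" "(-a, b)"] e(2)[of "b + b"] s by simp
  show "F (a, b) \<le> \<bar>a\<bar> + \<bar>b\<bar>"
    using tri[of "(a, 0)" "(0, b)"] e by simp
qed

lemma two_dim_lattice_mono:
  assumes F: "two_dim_lattice F" and "0 \<le> a" "a \<le> a'" "0 \<le> b" "b \<le> b'"
  shows "F (a, b) \<le> F (a', b')"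
proof -
  have tri: "F (x + y) \<le> F x + F y" and hom: "F (r *\<^sub>R x) = \<bar>r\<bar> * F x" for x y r
    using F unfolding two_dim_lattice_def is_norm_def by blast+
  have conv: "F (t *\<^sub>R x + (1 - t) *\<^sub>R y) \<le> t * F x + (1 - t) * F y" if "0 \<le> t" "t \<le> 1" for x y t
    using tri[of "t *\<^sub>R x" "(1 - t) *\<^sub>R y"] that by (simp add: hom)
  have s: "F (a, -b) = F (a, b)" "F (-a, b) = F (a, b)" for a b
    using F unfolding two_dim_lattice_def by (metis abs_minus_cancel, metis abs_minus_cancel)
  have l: "\<exists>t. 0 \<le> t \<and> t \<le> 1 \<and> c = t * d + (1 - t) * (- d)" if "0 \<le> c" "c \<le> d" for c d :: real
  proof (cases "d = 0")
    case False
    then show ?thesis using that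
      by (intro exI[of _ "(c / d + 1) / 2"]) (auto simp: field_simps)
  qed (use that in auto)
  obtain t where t: "0 \<le> t" "t \<le> 1" "a = t * a' + (1 - t) * (- a')" using l assms by blast
  obtain u where u: "0 \<le> u" "u \<le> 1" "b = u * b' + (1 - u) * (- b')" using l assms by blast
  have "F (a, b) \<le> t * F (a', b) + (1 - t) * F (-a', b)"
    using conv[OF t(1,2), of "(a', b)" "(-a', b)"] unfolding t(3)
    by (simp add: left_diff_distrib)
  also have "\<dots> = F (a', b)" by (simp add: s algebra_simps)
  also have "\<dots> \<le> u * F (a', b') + (1 - u) * F (a', -b')"
    using conv[OF u(1,2), of "(a', b')" "(a', -b')"] unfolding u(3)
    by (simp add: left_diff_distrib)
  also have "\<dots> = F (a', b')" by (simp add: s algebra_simps)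
  finally show ?thesis .
qed

lemma banach_norm_lattice_sum:
  assumes F: "two_dim_lattice F"
  shows "banach_norm (lattice_sum F (norm :: 'a::banach \<Rightarrow> real) (norm :: 'b::banach \<Rightarrow> real))"
    (is "banach_norm ?N")
proof (rule banach_normI)
  note b = two_dim_lattice_bounds[OF F]
  have tri: "F (x + y) \<le> F x + F y" and hom: "F (r *\<^sub>R x) = \<bar>r\<bar> * F x" 
    and nn: "F x \<ge> 0" and nz: "F x = 0 \<longleftrightarrow> x = 0" for x y r
    using F unfolding two_dim_lattice_def is_norm_def by blast+
  show "is_norm ?N"
    unfolding is_norm_def
  proof (intro conjI allI)
    fix x y :: "'a \<times> 'b" and r :: real
    obtain x1 x2 y1 y2 where xy: "x = (x1, x2)" "y = (y1, y2)" by (metis prod.exhaust)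
    show "?N x \<ge> 0" by (simp add: xy lattice_sum_def nn)
    show "?N x = 0 \<longleftrightarrow> x = 0" by (simp add: xy lattice_sum_def nz zero_prod_def)
    show "?N (r *\<^sub>R x) = \<bar>r\<bar> * ?N x"
      using hom[of "\<bar>r\<bar>" "(norm x1, norm x2)"] by (simp add: xy lattice_sum_def)
    have "?N (x + y) \<le> F (norm x1 + norm y1, norm x2 + norm y2)"
      unfolding xy lattice_sum_def by (simp add: two_dim_lattice_mono[OF F] norm_triangle_ineq)
    also have "\<dots> \<le> ?N x + ?N y"
      using tri[of "(norm x1, norm x2)" "(norm y1, norm y2)"] by (simp add: xy lattice_sum_def)
    finally show "?N (x + y) \<le> ?N x + ?N y" .
  qed
  fix \<sigma> :: "nat \<Rightarrow> 'a \<times> 'b"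
  assume C: "\<forall>e>0. \<exists>M. \<forall>n\<ge>M. \<forall>m\<ge>M. ?N (\<sigma> n - \<sigma> m) < e"
  have N: "?N z = F (norm (fst z), norm (snd z))" for z
    by (simp add: lattice_sum_def split_beta)
  have le: "norm (fst z) \<le> ?N z" "norm (snd z) \<le> ?N z" "?N z \<le> norm (fst z) + norm (snd z)" for z
    using b(1)[of "norm (fst z)" "norm (snd z)"] b(2)[of "norm (snd z)" "norm (fst z)"]
      b(3)[of "norm (fst z)" "norm (snd z)"] by (simp_all add: N)
  have "Cauchy (fst \<circ> \<sigma>)" "Cauchy (snd \<circ> \<sigma>)"
    unfolding Cauchy_def dist_norm o_def fst_diff[symmetric] snd_diff[symmetric]
    using C le(1,2) by (meson le_less_trans)+
  then obtain l1 l2 where l: "(\<lambda>n. fst (\<sigma> n)) \<longlonglongrightarrow> l1" "(\<lambda>n. snd (\<sigma> n)) \<longlonglongrightarrow> l2"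
    by (auto simp: Cauchy_convergent_iff convergent_def o_def)
  have lim: "(\<lambda>n. norm (fst (\<sigma> n) - l1) + norm (snd (\<sigma> n) - l2)) \<longlonglongrightarrow> 0"
    using tendsto_add[OF tendsto_norm_zero[OF LIM_zero[OF l(1)]] tendsto_norm_zero[OF LIM_zero[OF l(2)]]]
    by simp
  have "(\<lambda>n. ?N (\<sigma> n - (l1, l2))) \<longlonglongrightarrow> 0"
  proof (rule tendsto_sandwich[OF _ _ tendsto_const lim])
    show "\<forall>\<^sub>F n in sequentially. 0 \<le> ?N (\<sigma> n - (l1, l2))"
      using order_trans[OF norm_ge_zero le(1)] by (intro always_eventually allI)
    show "\<forall>\<^sub>F n in sequentially. ?N (\<sigma> n - (l1, l2))
            \<le> norm (fst (\<sigma> n) - l1) + norm (snd (\<sigma> n) - l2)"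
      using le(3)[of "\<sigma> _ - (l1, l2)"] by (intro always_eventually allI) simp
  qed
  then show "\<exists>l. (\<lambda>n. ?N (\<sigma> n - l)) \<longlonglongrightarrow> 0" by blast
qed

end

theory Submission
  imports Defs
begin

text \<open>
  The point \<open>f = (f\<^sub>1, f\<^sub>2)\<close> is the middle vertex of the two-edge arc \<open>S\<^sub>F\<^sup>+\<close>, because \<open>c\<^sub>1\<close> and \<open>c\<^sub>2\<close> do not
  both attain the value 1 anywhere else on the arc. Hence every \<open>y \<in> S\<^sub>F\<^sup>+\<close> lies on a common edge with
  \<open>f\<close>, so \<open>F (f + c y) = 1 + c\<close> for all \<open>c \<ge> 0\<close>. For a rank-1 operator \<open>T x = \<phi>(x) (w\<^sub>1, w\<^sub>2)\<close> with
  \<open>F (\<parallel>w\<^sub>1\<parallel>, \<parallel>w\<^sub>2\<parallel>) = 1\<close>, the Daugavet property yields a point \<open>x\<close> of the unit ball that almost norms \<open>\<phi>\<close> and is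
  simultaneously almost aligned with \<open>w\<^sub>1\<close> and \<open>w\<^sub>2\<close>; both coordinates of \<open>G x + T x\<close> then have almost
  maximal norm, and \<open>\<parallel>G x + T x\<parallel>\<close> is close to \<open>F (f + \<parallel>\<phi>\<parallel> (\<parallel>w\<^sub>1\<parallel>, \<parallel>w\<^sub>2\<parallel>)) = 1 + \<parallel>T\<parallel>\<close>.
\<close>

section \<open>Norming functionals\<close>

text \<open>Homogeneity is asked for only as an inequality, which passes to infima directly;
  \<open>sublinear_scale\<close> recovers equality. The case \<open>r = 0\<close> is included and
  yields \<open>p 0 = 0\<close>.\<close>

definition sublinear :: "('a::real_vector \<Rightarrow> real) \<Rightarrow> bool" where
  "sublinear p \<longleftrightarrow> (\<forall>x y. p (x + y) \<le> p x + p y) \<and> (\<forall>r x. 0 \<le> r \<longrightarrow> p (r *\<^sub>R x) \<le> r * p x)"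

lemma sublinear_add: "sublinear p \<Longrightarrow> p (x + y) \<le> p x + p y"
  by (simp add: sublinear_def)

lemma sublinear_scale_le: "sublinear p \<Longrightarrow> 0 \<le> r \<Longrightarrow> p (r *\<^sub>R x) \<le> r * p x"
  by (simp add: sublinear_def)

lemma sublinear_zero:
  assumes "sublinear p"
  shows "p 0 = 0"
  using sublinear_scale_le[OF assms, of 0 0] sublinear_add[OF assms, of 0 0] by simp

lemma sublinear_scale:
  assumes p: "sublinear p" and "0 \<le> r"
  shows "p (r *\<^sub>R x) = r * p x"
proof (cases "r = 0")
  case True
  then show ?thesis by (simp add: sublinear_zero[OF p])
next
  case False
  with \<open>0 \<le> r\<close> have "r > 0" by simp
  then have "p x \<le> inverse r * p (r *\<^sub>R x)"
    using sublinear_scale_le[OF p, of "inverse r" "r *\<^sub>R x"] by simp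
  then have "r * p x \<le> p (r *\<^sub>R x)"
    using \<open>r > 0\<close> by (simp add: field_simps)
  then show ?thesis
    using sublinear_scale_le[OF p \<open>0 \<le> r\<close>, of x] by linarith
qed

lemma sublinear_ge_uminus:
  assumes "sublinear p"
  shows "- p (- x) \<le> p x"
  using sublinear_add[OF assms, of x "- x"] sublinear_zero[OF assms] by simp

lemma sublinear_norm: "sublinear norm"
  by (simp add: sublinear_def norm_triangle_ineq)

text \<open>The inequalities need a witness \<open>k\<close> only somewhere in the family. This
  covers both later uses: a family indexed by a ray, where parameters add and scale, and a chain,
  where the smaller of two members serves.\<close>

lemma sublinear_INF:
  assumes "I \<noteq> {}"
    and bdd: "\<And>x. bdd_below ((\<lambda>i. g i x) ` I)"
    and add: "\<And>i j x y. i \<in> I \<Longrightarrow> j \<in> I \<Longrightarrow> \<exists>k\<in>I. g k (x + y) \<le> g i x + g j y"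
    and scale: "\<And>i r x. i \<in> I \<Longrightarrow> 0 \<le> r \<Longrightarrow> \<exists>k\<in>I. g k (r *\<^sub>R x) \<le> r * g i x"
  shows "sublinear (\<lambda>x. INF i\<in>I. g i x)"
proof -
  let ?u = "\<lambda>x. INF i\<in>I. g i x"
  have low: "?u x \<le> g i x" if "i \<in> I" for i x
    using bdd that by (rule cINF_lower)
  have "?u (x + y) \<le> ?u x + ?u y" for x y
  proof -
    have *: "?u (x + y) \<le> g i x + g j y" if "i \<in> I" "j \<in> I" for i j
      using add[OF that, of x y] low by (meson order_trans)
    have "?u (x + y) - g i x \<le> ?u y" if "i \<in> I" for i
    proof (rule cINF_greatest[OF \<open>I \<noteq> {}\<close>])
      fix j assume "j \<in> I"
      from *[OF that this] show "?u (x + y) - g i x \<le> g j y" by simp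
    qed
    then have "?u (x + y) - ?u y \<le> g i x" if "i \<in> I" for i
      using that by (simp add: algebra_simps)
    then have "?u (x + y) - ?u y \<le> ?u x"
      using \<open>I \<noteq> {}\<close> by (intro cINF_greatest) auto
    then show ?thesis by simp
  qed
  moreover have "?u (r *\<^sub>R x) \<le> r * ?u x" if "0 \<le> r" for r x
  proof -
    have *: "?u (r *\<^sub>R x) \<le> r * g i x" if "i \<in> I" for i
      using scale[OF that \<open>0 \<le> r\<close>, of x] low by (meson order_trans)
    show ?thesis
    proof (cases "r = 0")
      case True
      then show ?thesis using * \<open>I \<noteq> {}\<close> by auto
    next
      case False
      then have "?u (r *\<^sub>R x) / r \<le> ?u x"
        using * \<open>I \<noteq> {}\<close> \<open>0 \<le> r\<close> by (intro cINF_greatest) (auto simp: field_simps)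
      then show ?thesis using False \<open>0 \<le> r\<close> by (simp add: field_simps)
    qed
  qed
  ultimately show ?thesis by (simp add: sublinear_def)
qed

text \<open>Take \<open>q x\<close> to be the infimum over \<open>t \<ge> 0\<close> of
  \<open>p (x + t *\<^sub>R y) - t * p y\<close>: \<open>t = 0\<close> gives
  \<open>q \<le> p\<close> and \<open>t = 1\<close> gives the last bound. Subadditivity bounds the
  family below by \<open>- p (- x)\<close>. At \<open>x = - y\<close> the last bound reads
  \<open>q (- y) \<le> - p y\<close>, which is linear behaviour along \<open>y\<close>.\<close>

lemma sublinear_descend:
  assumes p: "sublinear p"
  obtains q where "sublinear q" "q \<le> p" "\<And>x. q x \<le> p (x + y) - p y"
proof -
  define g where "g t x = p (x + t *\<^sub>R y) - t * p y" for t x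
  let ?I = "{0::real..}"
  have bdd: "bdd_below ((\<lambda>t. g t x) ` ?I)" for x
  proof (rule bdd_belowI2[where m = "- p (- x)"])
    fix t :: real assume "t \<in> ?I"
    then show "- p (- x) \<le> g t x"
      using sublinear_add[OF p, of "x + t *\<^sub>R y" "- x"] by (simp add: g_def sublinear_scale[OF p])
  qed
  have "sublinear (\<lambda>x. INF t\<in>?I. g t x)"
  proof (rule sublinear_INF[OF _ bdd])
    fix s t :: real and x z assume "s \<in> ?I" "t \<in> ?I"
    moreover have "g (s + t) (x + z) \<le> g s x + g t z"
      using sublinear_add[OF p, of "x + s *\<^sub>R y" "z + t *\<^sub>R y"] by (simp add: g_def algebra_simps)
    ultimately show "\<exists>k\<in>?I. g k (x + z) \<le> g s x + g t z" by force
  next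
    fix t r :: real and x assume "t \<in> ?I" "0 \<le> r"
    moreover have "g (r * t) (r *\<^sub>R x) \<le> r * g t x"
      using sublinear_scale_le[OF p \<open>0 \<le> r\<close>, of "x + t *\<^sub>R y"] by (simp add: g_def algebra_simps)
    ultimately show "\<exists>k\<in>?I. g k (r *\<^sub>R x) \<le> r * g t x" by force
  qed auto
  moreover have "(INF t\<in>?I. g t x) \<le> g t x" if "t \<ge> 0" for t x
    using bdd that by (intro cINF_lower) auto
  from this[of 0] this[of 1] have "(\<lambda>x. INF t\<in>?I. g t x) \<le> p"
    "(INF t\<in>?I. g t x) \<le> p (x + y) - p y" for x
    by (simp_all add: g_def le_fun_def)
  ultimately show thesis using that by blast
qed

text \<open>Hahn--Banach: a minimal sublinear functional below \<open>q\<close> is linear, because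
  \<open>sublinear_descend\<close> cannot decrease it.\<close>

lemma sublinear_linear_below:
  assumes q: "sublinear q"
  obtains \<xi> where "linear \<xi>" "\<xi> \<le> q"
proof -
  define A where "A = {p. sublinear p \<and> p \<le> q}"
  \<comment> \<open>Zorn's lemma produces maximal elements, so the order on \<open>A\<close> is
    reversed; an upper bound of a chain is then its pointwise infimum.\<close>
  have "\<exists>m\<in>A. \<forall>a\<in>A. a \<le> m \<longrightarrow> a = m"
  proof (rule predicate_Zorn)
    show "partial_order_on A (relation_of (\<lambda>p r. r \<le> p) A)"
      by (rule partial_order_on_relation_ofI) auto
  next
    fix C assume "C \<in> Chains (relation_of (\<lambda>p r. r \<le> p) A)"
    then have CA: "C \<subseteq> A" and chain: "\<And>p r. p \<in> C \<Longrightarrow> r \<in> C \<Longrightarrow> p \<le> r \<or> r \<le> p"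
      unfolding Chains_def relation_of_def by blast+
    show "\<exists>u\<in>A. \<forall>a\<in>C. u \<le> a"
    proof (cases "C = {}")
      case True
      then show ?thesis using q by (auto simp: A_def)
    next
      case False
      have C: "sublinear p" "p x \<le> q x" if "p \<in> C" for p x
        using CA that by (auto simp: A_def le_fun_def)
      \<comment> \<open>The bound is uniform in \<open>p\<close>, since
        \<open>p x \<ge> - p (- x) \<ge> - q (- x)\<close>.\<close>
      have bdd: "bdd_below ((\<lambda>p. p x) ` C)" for x
        using sublinear_ge_uminus[OF C(1)] C(2)[of _ "- x"]
        by (intro bdd_belowI2[where m = "- q (- x)"]) (meson neg_le_iff_le order_trans)
      let ?u = "\<lambda>x. INF p\<in>C. p x"
      have "sublinear ?u"
      proof (rule sublinear_INF[OF False bdd])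
        fix p r x y assume pr: "p \<in> C" "r \<in> C"
        from chain[OF this] show "\<exists>k\<in>C. k (x + y) \<le> p x + r y"
        proof
          assume "p \<le> r"
          then have "p y \<le> r y" by (rule le_funD)
          then have "p (x + y) \<le> p x + r y"
            using sublinear_add[OF C(1)[OF pr(1)], of x y] by linarith
          then show ?thesis using pr(1) by blast
        next
          assume "r \<le> p"
          then have "r x \<le> p x" by (rule le_funD)
          then have "r (x + y) \<le> p x + r y"
            using sublinear_add[OF C(1)[OF pr(2)], of x y] by linarith
          then show ?thesis using pr(2) by blast
        qed
      qed (use sublinear_scale_le C(1) in blast)
      moreover have le: "?u \<le> p" if "p \<in> C" for p
        unfolding le_fun_def using cINF_lower[OF bdd that] by blast
      moreover have "?u \<le> q"
        using le False C(2) by (meson all_not_in_conv le_funI order_trans)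
      ultimately show ?thesis by (auto simp: A_def intro!: bexI[of _ ?u])
    qed
  qed
  then obtain m where m: "sublinear m" "m \<le> q"
    and min: "\<And>p. sublinear p \<Longrightarrow> p \<le> m \<Longrightarrow> p = m"
    unfolding A_def by (auto dest: order_trans)
  have add: "m (x + y) = m x + m y" for x y
  proof -
    obtain p where "sublinear p" "p \<le> m" and p: "\<And>x. p x \<le> m (x + y) - m y"
      using sublinear_descend[OF m(1), of y] by blast
    with min have "p = m" by blast
    with p have "m x \<le> m (x + y) - m y" by blast
    then show ?thesis using sublinear_add[OF m(1), of x y] by simp
  qed
  have neg: "m (- x) = - m x" for x
    using add[of x "- x"] sublinear_zero[OF m(1)] by simp
  have "m (r *\<^sub>R x) = r * m x" for r x
    using sublinear_scale[OF m(1), of r x] sublinear_scale[OF m(1), of "- r" x] neg[of "r *\<^sub>R x"]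
    by (cases "0 \<le> r") auto
  with add have "linear m" by (intro linearI) auto
  then show thesis using that m(2) by blast
qed

text \<open>Descending from the norm in the direction \<open>u\<close> gives
  \<open>q (- u) \<le> - norm u\<close>, so any linear functional below \<open>q\<close> attains
  \<open>norm u\<close> at \<open>u\<close>.\<close>

lemma norming_functional:
  fixes u :: "'a::real_normed_vector"
  obtains \<xi> :: "'a \<Rightarrow> real" where "bounded_linear \<xi>" "\<And>x. \<bar>\<xi> x\<bar> \<le> norm x" "\<xi> u = norm u"
proof -
  obtain q where q: "sublinear q" "q \<le> norm" "\<And>x. q x \<le> norm (x + u) - norm u"
    using sublinear_descend[OF sublinear_norm, of u] by blast
  obtain \<xi> where \<xi>: "linear \<xi>" "\<xi> \<le> q"
    using sublinear_linear_below[OF q(1)] by blast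
  have le: "\<xi> x \<le> norm x" for x
    using \<xi>(2) q(2) by (meson le_funD order_trans)
  have abs: "\<bar>\<xi> x\<bar> \<le> norm x" for x
    using le[of x] le[of "- x"] linear_neg[OF \<xi>(1), of x] by simp
  have "\<xi> (- u) \<le> norm (- u + u) - norm u"
    using \<xi>(2) q(3) by (meson le_funD order_trans)
  then have "\<xi> u = norm u"
    using le[of u] linear_neg[OF \<xi>(1), of u] by simp
  moreover have "bounded_linear \<xi>"
    using \<xi>(1) abs by (intro bounded_linear_intro[where K = 1]) (auto simp: linear_add linear_scale)
  ultimately show thesis using that abs by blast
qed


section \<open>Operator norms and rank-one operators\<close>

lemma op_norm_bound:
  fixes T :: "'a::real_normed_vector \<Rightarrow> 'b::real_vector"
  assumes N: "is_norm N" and T: "bounded_linear_wrt norm N T"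
  shows "N (T x) \<le> op_norm norm N T * norm x"
proof (cases "x = 0")
  case True
  moreover have "N 0 = 0" using N unfolding is_norm_def by blast
  ultimately show ?thesis
    using T by (simp add: bounded_linear_wrt_def linear_0)
next
  case False
  obtain K where K: "\<And>x. N (T x) \<le> norm x * K"
    using T unfolding bounded_linear_wrt_def by blast
  \<comment> \<open>The quotient at \<open>x = 0\<close> is 0 by the convention for division, so a
    nonnegative bound is required, while \<open>K\<close> could be negative on a trivial
    space.\<close>
  have "N (T x) \<le> max K 0 * norm x" for x
    using K[of x] mult_left_mono[of K "max K 0" "norm x"] by (simp add: mult.commute)
  then have "N (T x) / norm x \<le> max K 0" for x
    by (cases "x = 0") (auto simp: pos_divide_le_eq)
  then have "bdd_above (range (\<lambda>x. N (T x) / norm x))"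
    by (intro bdd_aboveI) auto
  then have "N (T x) / norm x \<le> op_norm norm N T"
    unfolding op_norm_def by (intro cSUP_upper) auto
  then show ?thesis using False by (simp add: field_simps)
qed

lemma op_norm_le:
  fixes T :: "'a::real_normed_vector \<Rightarrow> 'b::real_vector"
  assumes "0 \<le> K" "\<And>x. N (T x) \<le> K * norm x"
  shows "op_norm norm N T \<le> K"
  unfolding op_norm_def
proof (rule cSUP_least)
  fix x
  show "N (T x) / norm x \<le> K"
    using assms by (cases "x = 0") (auto simp: field_simps)
qed simp

text \<open>Otherwise \<open>K\<close> bounds \<open>f\<close> on the unit ball, and by homogeneity
  \<open>onorm f \<le> K\<close>.\<close>

lemma onorm_gtE:
  fixes f :: "'a::real_normed_vector \<Rightarrow> 'b::real_normed_vector"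
  assumes f: "bounded_linear f" and K: "0 \<le> K" "K < onorm f"
  obtains x where "norm x \<le> 1" "K < norm (f x)"
proof (rule ccontr)
  assume "\<not> thesis"
  then have le: "norm (f x) \<le> K" if "norm x \<le> 1" for x
    using that \<open>\<And>x. norm x \<le> 1 \<Longrightarrow> K < norm (f x) \<Longrightarrow> thesis\<close> by force
  have "norm (f x) \<le> K * norm x" for x
  proof (cases "x = 0")
    case True
    then show ?thesis using f by (simp add: linear_simps(3))
  next
    case False
    have "norm (f (x /\<^sub>R norm x)) \<le> K" using False by (intro le) simp
    then show ?thesis
      using False f by (simp add: linear_simps(5) field_simps)
  qed
  then have "onorm f \<le> K" using K(1) by (intro onorm_bound)
  with K(2) show False by simp
qed

lemma onorm_functional_gtE:
  fixes f :: "'a::real_normed_vector \<Rightarrow> real"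
  assumes f: "bounded_linear f" and K: "0 \<le> K" "K < onorm f"
  obtains x where "norm x \<le> 1" "K < f x"
proof -
  obtain x where x: "norm x \<le> 1" "K < \<bar>f x\<bar>"
    using onorm_gtE[OF assms] by (metis real_norm_def)
  have "f (- x) = - f x" using f by (simp add: linear_simps(4))
  with x that[of x] that[of "- x"] show thesis
    by (cases "0 \<le> f x") auto
qed

lemma rank_one_scaleR:
  assumes \<phi>: "linear \<phi>" "\<phi> u \<noteq> (0::real)" and y: "y \<noteq> 0"
  shows "rank_one (\<lambda>x. \<phi> x *\<^sub>R y)"
proof -
  have "range (\<lambda>x. \<phi> x *\<^sub>R y) = span {y}"
  proof
    show "range (\<lambda>x. \<phi> x *\<^sub>R y) \<subseteq> span {y}" by (auto simp: span_singleton)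
    show "span {y} \<subseteq> range (\<lambda>x. \<phi> x *\<^sub>R y)"
    proof
      fix z assume "z \<in> span {y}"
      then obtain k where "z = k *\<^sub>R y" by (auto simp: span_singleton)
      then have "z = \<phi> ((k / \<phi> u) *\<^sub>R u) *\<^sub>R y" using \<phi> by (simp add: linear_scale)
      then show "z \<in> range (\<lambda>x. \<phi> x *\<^sub>R y)" by blast
    qed
  qed
  moreover have "independent {y}" using y by simp
  ultimately show ?thesis by (simp add: rank_one_def dim_eq_card_independent)
qed

text \<open>Normalising a basis vector of the range puts the whole size of \<open>T\<close> into
  \<open>\<phi>\<close>, so that \<open>N (T x) = \<bar>\<phi> x\<bar>\<close>.\<close>

lemma rank_oneE:
  assumes T: "linear T" "rank_one T" and N: "is_norm N"
  obtains \<phi> w where "linear \<phi>" "N w = (1::real)" "\<And>x. T x = \<phi> x *\<^sub>R w"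
proof -
  obtain B where B: "B \<subseteq> range T" "independent B" "range T \<subseteq> span B" "card B = dim (range T)"
    by (rule basis_exists)
  then obtain b where b: "B = {b}" using T(2) by (auto simp: rank_one_def card_1_singleton_iff)
  with B(2) have "b \<noteq> 0" by auto
  then have Nb: "N b > 0" using N unfolding is_norm_def by (metis less_eq_real_def)
  define w where "w = b /\<^sub>R N b"
  have w: "N w = 1"
  proof -
    have "N w = \<bar>inverse (N b)\<bar> * N b" using N unfolding is_norm_def w_def by blast
    then show ?thesis using Nb by simp
  qed
  have "w \<noteq> 0" using \<open>b \<noteq> 0\<close> Nb by (simp add: w_def)
  have "\<exists>k. T x = k *\<^sub>R w" for x
  proof -
    have "T x \<in> span {b}" using B(3) b by blast
    then obtain k where "T x = k *\<^sub>R b" by (auto simp: span_singleton)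
    then have "T x = (k * N b) *\<^sub>R w" using Nb by (simp add: w_def)
    then show ?thesis ..
  qed
  then obtain \<phi> where \<phi>: "\<And>x. T x = \<phi> x *\<^sub>R w" by metis
  have "linear \<phi>"
  proof (rule linearI)
    fix x y and r :: real
    have "\<phi> (x + y) *\<^sub>R w = (\<phi> x + \<phi> y) *\<^sub>R w"
      using linear_add[OF T(1), of x y] by (simp add: \<phi> scaleR_add_left)
    then show "\<phi> (x + y) = \<phi> x + \<phi> y" using \<open>w \<noteq> 0\<close> by (simp only: scaleR_cancel_right) simp
    have "\<phi> (r *\<^sub>R x) *\<^sub>R w = (r * \<phi> x) *\<^sub>R w"
      using linear_scale[OF T(1), of r x] by (simp add: \<phi>)
    then show "\<phi> (r *\<^sub>R x) = r *\<^sub>R \<phi> x" using \<open>w \<noteq> 0\<close> by (simp only: scaleR_cancel_right) simp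
  qed
  with w \<phi> that show thesis by blast
qed

section \<open>Slices in spaces with the Daugavet property\<close>

text \<open>A Daugavet center is nonzero by definition; for \<open>id\<close> this means that the
  space contains a nonzero vector.\<close>

lemma daugavet_property_nontrivial:
  assumes "daugavet_property (norm :: 'a::real_normed_vector \<Rightarrow> real)"
  obtains u :: "'a::real_normed_vector" where "norm u = 1"
proof -
  obtain z :: 'a where "z \<noteq> 0"
    using assms by (fastforce simp: daugavet_property_def daugavet_center_def)
  then have "norm (z /\<^sub>R norm z) = 1" by simp
  then show thesis by (rule that)
qed

lemma daugavet_property_onorm:
  fixes \<phi> :: "'a::real_normed_vector \<Rightarrow> real"
  assumes X: "daugavet_property (norm :: 'a \<Rightarrow> real)"
    and \<phi>: "bounded_linear \<phi>" "onorm \<phi> = 1" and y: "norm y = 1"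
  shows "onorm (\<lambda>x. x + \<phi> x *\<^sub>R y) = 2"
proof -
  obtain u where u: "norm u \<le> 1" "0 < \<phi> u"
    using onorm_functional_gtE[OF \<phi>(1), of 0] \<phi>(2) by auto
  have T: "bounded_linear (\<lambda>x. \<phi> x *\<^sub>R y)"
    using \<phi>(1) by (rule bounded_linear_scaleR_const)
  have "rank_one (\<lambda>x. \<phi> x *\<^sub>R y)"
    using \<phi>(1) u y by (intro rank_one_scaleR[of _ u]) (auto simp: bounded_linear.linear)
  then have "onorm (\<lambda>x. x + \<phi> x *\<^sub>R y) = onorm (id :: 'a \<Rightarrow> 'a) + onorm (\<lambda>x. \<phi> x *\<^sub>R y)"
    using X T
    unfolding daugavet_property_def daugavet_center_def bounded_linear_wrt_norm op_norm_norm id_apply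
    by blast
  moreover have "onorm (id :: 'a \<Rightarrow> 'a) = 1"
  proof (rule antisym)
    show "onorm (id :: 'a \<Rightarrow> 'a) \<le> 1" by (rule onorm_bound) auto
    show "1 \<le> onorm (id :: 'a \<Rightarrow> 'a)"
      using onorm[of "id :: 'a \<Rightarrow> 'a" y] y by (simp add: id_def bounded_linear_ident)
  qed
  ultimately show ?thesis by (simp add: onorm_scaleR_left[OF \<phi>(1)] \<phi>(2) y)
qed

text \<open>For \<open>x\<^sub>0\<close> almost attaining the norm 2 of \<open>Id + \<phi> \<otimes> y\<close> and \<open>\<xi>\<close> norming its image, the
  functional defining the smaller slice is the normalised \<open>\<xi> + \<xi>(y) \<phi>\<close>, the adjoint image of \<open>\<xi>\<close>.\<close>

lemma daugavet_subslice:
  fixes \<phi> :: "'a::real_normed_vector \<Rightarrow> real"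
  assumes X: "daugavet_property (norm :: 'a \<Rightarrow> real)"
    and \<phi>: "bounded_linear \<phi>" "onorm \<phi> = 1" and y: "norm y = 1" and e: "0 < e" "e \<le> 1"
  obtains \<psi> :: "'a \<Rightarrow> real" and d where "bounded_linear \<psi>" "onorm \<psi> = 1" "0 < d"
    "\<forall>x. norm x \<le> 1 \<longrightarrow> 1 - d < \<psi> x \<longrightarrow> 1 - e < \<phi> x \<and> 2 - 2 * e < norm (x + y)"
proof -
  have \<phi>_le: "\<bar>\<phi> x\<bar> \<le> norm x" for x
    using onorm[OF \<phi>(1), of x] \<phi>(2) by simp
  have "bounded_linear (\<lambda>x. x + \<phi> x *\<^sub>R y)"
    using \<phi>(1) by (intro bounded_linear_add bounded_linear_ident bounded_linear_scaleR_const)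
  then obtain x1 where x1: "norm x1 \<le> 1" "2 - e / 2 < norm (x1 + \<phi> x1 *\<^sub>R y)"
    using onorm_gtE[of "\<lambda>x. x + \<phi> x *\<^sub>R y" "2 - e / 2"] daugavet_property_onorm[OF X \<phi> y] e by auto
  \<comment> \<open>The operator is odd, so the sign can be chosen with
    \<open>\<phi> x0 \<ge> 0\<close>; this is what makes \<open>\<xi> y\<close> positive
    below.\<close>
  define x0 where "x0 = (if 0 \<le> \<phi> x1 then x1 else - x1)"
  have "norm (- x1 + \<phi> (- x1) *\<^sub>R y) = norm (x1 + \<phi> x1 *\<^sub>R y)"
    using norm_minus_cancel[of "x1 + \<phi> x1 *\<^sub>R y"] bounded_linear.linear[OF \<phi>(1)]
    by (simp add: linear_neg)
  then have x0: "norm x0 \<le> 1" "0 \<le> \<phi> x0" "2 - e / 2 < norm (x0 + \<phi> x0 *\<^sub>R y)"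
    using x1 \<phi>(1) by (auto simp: x0_def linear_simps(4))
  obtain \<xi> :: "'a \<Rightarrow> real" where \<xi>: "bounded_linear \<xi>" "\<And>x. \<bar>\<xi> x\<bar> \<le> norm x"
    "\<xi> (x0 + \<phi> x0 *\<^sub>R y) = norm (x0 + \<phi> x0 *\<^sub>R y)"
    using norming_functional by blast
  have \<xi>_le: "\<xi> x \<le> norm x" for x using \<xi>(2)[of x] by linarith
  have \<xi>0: "2 - e / 2 < \<xi> x0 + \<phi> x0 * \<xi> y"
    using x0(3) \<xi>(3) \<xi>(1) by (simp add: linear_simps)
  \<comment> \<open>Two summands, each at most 1, have a sum close to 2, so each is close to 1. As
    \<open>0 \<le> \<phi> x0 \<le> 1\<close>, the factor \<open>\<xi> y\<close> is then close to 1
    as well.\<close>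
  then have *: "1 - e / 2 < \<phi> x0 * \<xi> y" using \<xi>_le[of x0] x0(1) by linarith
  then have "0 < \<phi> x0 * \<xi> y" using e by linarith
  then have pos: "0 < \<xi> y" using x0(2) by (simp add: zero_less_mult_iff)
  have "\<phi> x0 * \<xi> y \<le> \<xi> y"
    using pos x0 \<phi>_le[of x0] by (intro mult_left_le_one_le) auto
  with * have \<xi>y: "1 - e / 2 < \<xi> y" by linarith
  have \<xi>y1: "\<xi> y \<le> 1" using \<xi>_le[of y] y by simp
  define \<rho> where "\<rho> x = \<xi> x + \<xi> y * \<phi> x" for x
  have \<rho>: "bounded_linear \<rho>"
    unfolding \<rho>_def using \<xi>(1) \<phi>(1) by (intro bounded_linear_add bounded_linear_const_mult)
  have "2 - e / 2 < \<rho> x0" using \<xi>0 by (simp add: \<rho>_def mult.commute)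
  also have "\<rho> x0 \<le> onorm \<rho> * norm x0" using onorm[OF \<rho>, of x0] by simp
  also have "\<dots> \<le> onorm \<rho>" using x0(1) onorm_pos_le[OF \<rho>] by (simp add: mult_left_le)
  finally have k: "2 - e / 2 < onorm \<rho>" .
  then have kpos: "0 < onorm \<rho>" using e by linarith
  \<comment> \<open>The width \<open>e / 4\<close> is chosen because (1 - e/4)(2 - e/2) = 2 - e +
    e^2/8, so \<open>\<rho> x > 2 - e\<close> throughout the new slice.\<close>
  show thesis
  proof (rule that[of "\<lambda>x. inverse (onorm \<rho>) *\<^sub>R \<rho> x" "e / 4"]; (intro allI impI)?)
    show "bounded_linear (\<lambda>x. inverse (onorm \<rho>) *\<^sub>R \<rho> x)"
      using \<rho> by (rule bounded_linear_const_scaleR)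
    show "onorm (\<lambda>x. inverse (onorm \<rho>) *\<^sub>R \<rho> x) = 1"
      using onorm_scaleR[OF \<rho>] kpos by simp
    show "0 < e / 4" using e by simp
  next
    fix x assume x: "norm x \<le> 1" "1 - e / 4 < inverse (onorm \<rho>) *\<^sub>R \<rho> x"
    have "2 - e \<le> (1 - e / 4) * (2 - e / 2)" by (simp add: algebra_simps)
    also have "\<dots> \<le> (1 - e / 4) * onorm \<rho>" using k e by (intro mult_left_mono) auto
    also have "\<dots> < \<rho> x" using x(2) kpos by (simp add: field_simps)
    finally have r: "2 - e < \<xi> x + \<xi> y * \<phi> x" by (simp add: \<rho>_def)
    \<comment> \<open>Both summands in \<open>r\<close> are at most 1, hence both exceed
      \<open>1 - e\<close>. The first, with \<open>\<xi> y > 1 - e / 2\<close>, gives alignment with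
      \<open>y\<close>; the second, with \<open>\<xi> y \<le> 1\<close>, gives
      \<open>\<phi> x > 1 - e\<close>.\<close>
    have \<xi>x: "\<xi> x \<le> 1" using \<xi>_le[of x] x(1) by linarith
    have \<phi>x: "\<phi> x \<le> 1" using \<phi>_le[of x] x(1) by linarith
    have "\<xi> y * \<phi> x \<le> 1"
      using mult_left_mono[OF \<phi>x, of "\<xi> y"] pos \<xi>y1 by linarith
    with r have "1 - e < \<xi> x" by linarith
    with \<xi>y have "2 - 2 * e < \<xi> (x + y)" using e \<xi>(1) by (simp add: linear_simps)
    with \<xi>_le[of "x + y"] have "2 - 2 * e < norm (x + y)" by linarith
    moreover have "1 - e < \<phi> x"
    proof -
      have a: "1 - e < \<xi> y * \<phi> x" using r \<xi>x by linarith
      then have "0 < \<xi> y * \<phi> x" using e by linarith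
      then have "0 < \<phi> x" using pos by (simp add: zero_less_mult_iff)
      then have "\<xi> y * \<phi> x \<le> \<phi> x" using pos \<xi>y1 by (intro mult_left_le_one_le) auto
      with a show ?thesis by linarith
    qed
    ultimately show "1 - e < \<phi> x \<and> 2 - 2 * e < norm (x + y)" by blast
  qed
qed

text \<open>The smaller slice found for \<open>y1\<close> is again a slice given by a norm-one
  functional, so the construction can be repeated inside it for \<open>y2\<close>. Any point of the
  innermost slice serves both vectors.\<close>

lemma daugavet_common_slice_point:
  fixes \<phi> :: "'a::real_normed_vector \<Rightarrow> real"
  assumes X: "daugavet_property (norm :: 'a \<Rightarrow> real)"
    and \<phi>: "bounded_linear \<phi>" "onorm \<phi> = 1" and y: "norm y1 = 1" "norm y2 = 1" and e: "0 < e" "e \<le> 1"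
  obtains x where "norm x \<le> 1" "1 - e < \<phi> x" "2 - 2 * e < norm (x + y1)" "2 - 2 * e < norm (x + y2)"
proof -
  obtain \<psi>1 :: "'a \<Rightarrow> real" and d1 where 1: "bounded_linear \<psi>1" "onorm \<psi>1 = 1" "0 < d1"
    "\<forall>x. norm x \<le> 1 \<longrightarrow> 1 - d1 < \<psi>1 x \<longrightarrow> 1 - e < \<phi> x \<and> 2 - 2 * e < norm (x + y1)"
    using daugavet_subslice[OF X \<phi> y(1) e] by blast
  \<comment> \<open>The bound \<open>d1\<close> nests the second slice in the first; the bound
    \<open>e\<close> keeps \<open>d \<le> 1\<close> and the defect for \<open>y2\<close> at most
    \<open>2 * e\<close>.\<close>
  define d where "d = min e d1"
  have d: "0 < d" "d \<le> 1" "d \<le> e" "d \<le> d1" using e 1(3) by (auto simp: d_def)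
  obtain \<psi>2 :: "'a \<Rightarrow> real" and d2 where 2: "bounded_linear \<psi>2" "onorm \<psi>2 = 1" "0 < d2"
    "\<forall>x. norm x \<le> 1 \<longrightarrow> 1 - d2 < \<psi>2 x \<longrightarrow> 1 - d < \<psi>1 x \<and> 2 - 2 * d < norm (x + y2)"
    using daugavet_subslice[OF X 1(1,2) y(2) d(1,2)] by blast
  \<comment> \<open>\<open>d2\<close> may exceed 1, while \<open>onorm_functional_gtE\<close> takes
    a nonnegative threshold.\<close>
  obtain x where x: "norm x \<le> 1" "max 0 (1 - d2) < \<psi>2 x"
    using onorm_functional_gtE[OF 2(1), of "max 0 (1 - d2)"] 2(2,3) by auto
  then have "1 - d < \<psi>1 x" "2 - 2 * d < norm (x + y2)" using 2(4) by auto
  with 1(4)[rule_format, of x] x(1) d(3,4) show thesis by (intro that[of x]) auto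
qed

text \<open>For \<open>b \<le> a\<close>, subtract \<open>(a - b) *\<^sub>R y\<close> from
  \<open>a *\<^sub>R (x + y)\<close>: the norm is at least a(2 - e) - (a - b) = a + b - ae, which is
  at least (1 - e)(a + b). The other case is symmetric.\<close>

lemma norm_combination_ge:
  fixes x y :: "'a::real_normed_vector"
  assumes "norm x \<le> 1" "norm y \<le> 1" "2 - e \<le> norm (x + y)" "0 \<le> a" "0 \<le> b" "0 \<le> e"
  shows "(1 - e) * (a + b) \<le> norm (a *\<^sub>R x + b *\<^sub>R y)"
proof -
  have main: "(1 - e) * (a + b) \<le> norm (a *\<^sub>R x + b *\<^sub>R y)"
    if "norm y \<le> 1" "2 - e \<le> norm (x + y)" "b \<le> a" "0 \<le> b" for x y :: 'a and a b
  proof -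
    have "a * (2 - e) \<le> norm (a *\<^sub>R (x + y))"
      using that by (simp add: mult_left_mono)
    also have "a *\<^sub>R (x + y) = (a *\<^sub>R x + b *\<^sub>R y) + (a - b) *\<^sub>R y"
      by (simp add: algebra_simps)
    also have "norm \<dots> \<le> norm (a *\<^sub>R x + b *\<^sub>R y) + (a - b) * norm y"
      using that norm_triangle_ineq[of "a *\<^sub>R x + b *\<^sub>R y" "(a - b) *\<^sub>R y"] by simp
    also have "(a - b) * norm y \<le> a - b" using that by (simp add: mult_left_le)
    finally have "a * (2 - e) \<le> norm (a *\<^sub>R x + b *\<^sub>R y) + (a - b)" by simp
    moreover have "0 \<le> b * e" using that assms by simp
    ultimately show ?thesis by (simp add: algebra_simps)
  qed
  show ?thesis
    using main[of y x b a] main[of x y a b] assms by (cases "b \<le> a") (auto simp: add.commute)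
qed

section \<open>Two-edge polygonal lattices\<close>

text \<open>If the middle vertex lay on the chord, the two edges would together form one segment
  inside \<open>S\<close>, against the maximality of the first edge.\<close>

lemma polygonal_arc_2E:
  assumes "polygonal_arc S 2"
  obtains v where "S = closed_segment (1, 0) v \<union> closed_segment v (0, 1)"
    "v \<notin> closed_segment (1, 0) (0, 1)"
proof -
  obtain p :: "nat \<Rightarrow> real \<times> real" where p: "p 0 = (1, 0)" "p 2 = (0, 1)"
    "S = (\<Union>i<2. closed_segment (p i) (p (Suc i)))"
    "\<And>i. i < 2 \<Longrightarrow> p i \<noteq> p (Suc i) \<and> maximal_segment S (closed_segment (p i) (p (Suc i)))"
    using assms unfolding polygonal_arc_def by blast
  have S: "S = closed_segment (1, 0) (p 1) \<union> closed_segment (p 1) (0, 1)"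
    using p(1,2) unfolding p(3) by (auto simp: numeral_2_eq_2 lessThan_Suc)
  have ne: "p 1 \<noteq> (0, 1)" using p(4)[of 1] p(2) by (simp add: numeral_2_eq_2)
  have "maximal_segment S (closed_segment (1, 0) (p 1))" using p(4)[of 0] p(1) by simp
  then have max: "closed_segment (1, 0) (p 1) \<subseteq> closed_segment u w \<Longrightarrow> closed_segment u w \<subseteq> S \<Longrightarrow>
      closed_segment u w = closed_segment (1, 0) (p 1)" for u w
    unfolding maximal_segment_def by blast
  have "p 1 \<notin> closed_segment (1, 0) (0, 1)"
  proof
    assume v: "p 1 \<in> closed_segment (1, 0) (0, 1)"
    then have "closed_segment (1, 0) (0, 1) = S" "closed_segment (1, 0) (p 1) \<subseteq> closed_segment (1, 0) (0, 1)"
      unfolding S by (simp_all add: Un_closed_segment subset_closed_segment)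
    then have "closed_segment (1, 0) (0, 1) = closed_segment (1, 0) (p 1)" using max by blast
    then have "{(1, 0), (0, 1)} = {(1, 0), p 1}" by (simp only: closed_segment_eq)
    with ne show False by (auto simp: doubleton_eq_iff)
  qed
  with S that show thesis by blast
qed

text \<open>Each \<open>y\<close> on the arc shares an edge with the vertex \<open>v\<close>, and
  that edge contains \<open>v + c *\<^sub>R y\<close> divided by \<open>1 + c\<close>, which
  therefore has norm 1.\<close>

lemma vertex_plus_sphere:
  assumes F: "is_norm F"
    and S: "pos_sphere F = closed_segment a v \<union> closed_segment v b"
    and y: "y \<in> pos_sphere F" and c: "0 \<le> c"
  shows "F (v + c *\<^sub>R y) = 1 + c"
proof -
  define z where "z = (1 / (1 + c)) *\<^sub>R v + (c / (1 + c)) *\<^sub>R y"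
  have conv: "z \<in> closed_segment p q" if "v \<in> closed_segment p q" "y \<in> closed_segment p q" for p q
    unfolding z_def using that c
    by (intro convexD[OF convex_closed_segment]) (auto simp: field_simps)
  have "z \<in> pos_sphere F" using y conv unfolding S by (meson Un_iff ends_in_segment)
  then have "F z = 1" by (auto simp: pos_sphere_def)
  moreover have "v + c *\<^sub>R y = (1 + c) *\<^sub>R z" using c by (simp add: z_def scaleR_add_right)
  moreover have "F ((1 + c) *\<^sub>R z) = \<bar>1 + c\<bar> * F z" using F unfolding is_norm_def by blast
  ultimately show ?thesis using c by simp
qed

section \<open>Dual unit sphere and supporting lines\<close>

lemma dual_lattice_le_iff:
  assumes F: "two_dim_lattice F"
  shows "dual_lattice F (g1, g2) \<le> K \<longleftrightarrow>
    (\<forall>a1 a2. F (a1, a2) \<le> 1 \<longrightarrow> \<bar>g1 * a1 + g2 * a2\<bar> \<le> K)"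
proof -
  \<comment> \<open>The unit ball lies in the square of points with coordinates in [-1, 1], so the
    supremum is taken over a bounded set.\<close>
  have "bdd_above ((\<lambda>(a1, a2). \<bar>g1 * a1 + g2 * a2\<bar>) ` {a. F a \<le> 1})"
  proof (rule bdd_aboveI2[where M = "\<bar>g1\<bar> + \<bar>g2\<bar>"], clarify)
    fix a1 a2 assume "F (a1, a2) \<le> 1"
    then have "\<bar>a1\<bar> \<le> 1" "\<bar>a2\<bar> \<le> 1"
      using two_dim_lattice_bounds(1)[OF F, of a1 a2] two_dim_lattice_bounds(2)[OF F, of a2 a1] by auto
    then have "\<bar>g1 * a1\<bar> \<le> \<bar>g1\<bar>" "\<bar>g2 * a2\<bar> \<le> \<bar>g2\<bar>" by (simp_all add: abs_mult mult_left_le)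
    then show "\<bar>g1 * a1 + g2 * a2\<bar> \<le> \<bar>g1\<bar> + \<bar>g2\<bar>" by linarith
  qed
  moreover have "F (0, 0) = 0"
    using two_dim_lattice_bounds(3)[OF F, of 0 0] two_dim_lattice_bounds(1)[OF F, of 0 0] by simp
  then have "(0, 0) \<in> {a. F a \<le> 1}" by simp
  ultimately show ?thesis
    unfolding dual_lattice_def by (subst case_prod_conv, subst cSUP_le_iff) auto
qed

text \<open>The unit vectors \<open>(1, 0)\<close> and \<open>(0, 1)\<close> force dual norm at
  least 1 on \<open>(1, y)\<close> and \<open>(x, 1)\<close>, so only the upper bound 1 has to be
  tested.\<close>

lemma dual_pos_sphere_iff:
  assumes F: "two_dim_lattice F"
  shows "(1, y) \<in> pos_sphere (dual_lattice F) \<longleftrightarrow>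
      0 \<le> y \<and> (\<forall>a1 a2. F (a1, a2) \<le> 1 \<longrightarrow> \<bar>a1 + y * a2\<bar> \<le> 1)" (is ?thesis1)
    and "(x, 1) \<in> pos_sphere (dual_lattice F) \<longleftrightarrow>
      0 \<le> x \<and> (\<forall>a1 a2. F (a1, a2) \<le> 1 \<longrightarrow> \<bar>x * a1 + a2\<bar> \<le> 1)" (is ?thesis2)
proof -
  note le = dual_lattice_le_iff[OF F]
  have e: "F (1, 0) = 1" "F (0, 1) = 1" using F by (auto simp: two_dim_lattice_def)
  have "1 \<le> dual_lattice F (1, y)" "1 \<le> dual_lattice F (x, 1)"
    using le[of 1 y "dual_lattice F (1, y)", simplified, rule_format, of 1 0]
      le[of x 1 "dual_lattice F (x, 1)", simplified, rule_format, of 0 1] e by simp_all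
  then have "dual_lattice F (1, y) = 1 \<longleftrightarrow> dual_lattice F (1, y) \<le> 1"
    "dual_lattice F (x, 1) = 1 \<longleftrightarrow> dual_lattice F (x, 1) \<le> 1" by auto
  then show ?thesis1 ?thesis2
    unfolding pos_sphere_def by (auto simp: le)
qed

text \<open>\<open>GREATEST\<close> has its intended meaning only if a maximum is attained;
  compactness and the witness \<open>z\<close> provide one.\<close>

lemma compact_Greatest:
  fixes P :: "real \<Rightarrow> bool"
  assumes "compact {y. P y}" "P z"
  shows "P (GREATEST y. P y)"
proof -
  obtain s where "P s" "\<And>y. P y \<Longrightarrow> y \<le> s"
    using compact_attains_sup[OF assms(1)] assms(2) by auto
  then show ?thesis by (metis Greatest_equality)
qed

text \<open>Both parameter sets are closed, contained in [0, 1] and contain 0, so the maxima that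
  define \<open>c1\<close> and \<open>c2\<close> are attained.\<close>

lemma dual_sphere_Greatest:
  assumes F: "two_dim_lattice F"
  shows "(1, GREATEST y. (1, y) \<in> pos_sphere (dual_lattice F)) \<in> pos_sphere (dual_lattice F)"
    and "(GREATEST x. (x, 1) \<in> pos_sphere (dual_lattice F), 1) \<in> pos_sphere (dual_lattice F)"
proof -
  have e: "F (1, 0) = 1" "F (0, 1) = 1" using F by (auto simp: two_dim_lattice_def)
  have b: "\<bar>a1\<bar> \<le> 1" "\<bar>a2\<bar> \<le> 1" if "F (a1, a2) \<le> 1" for a1 a2
    using two_dim_lattice_bounds(1)[OF F, of a1 a2] two_dim_lattice_bounds(2)[OF F, of a2 a1] that by auto
  show "(1, GREATEST y. (1, y) \<in> pos_sphere (dual_lattice F)) \<in> pos_sphere (dual_lattice F)"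
  proof (rule compact_Greatest)
    have "closed {y. (1, y) \<in> pos_sphere (dual_lattice F)}"
      unfolding dual_pos_sphere_iff[OF F]
      by (intro closed_Collect_conj closed_Collect_all closed_Collect_imp open_Collect_const
          closed_Collect_le continuous_intros)
    moreover have "{y. (1, y) \<in> pos_sphere (dual_lattice F)} \<subseteq> {0..1}"
      unfolding dual_pos_sphere_iff[OF F]
    proof clarsimp
      fix y assume "\<forall>a1 a2. F (a1, a2) \<le> 1 \<longrightarrow> \<bar>a1 + y * a2\<bar> \<le> 1"
      from this[rule_format, of 0 1] e show "y \<le> 1" by simp
    qed
    ultimately show "compact {y. (1, y) \<in> pos_sphere (dual_lattice F)}"
      using compact_Icc compact_Int_closed by (metis inf.absorb_iff2)
    show "(1, 0) \<in> pos_sphere (dual_lattice F)"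
      unfolding dual_pos_sphere_iff[OF F] using b by auto
  qed
  show "(GREATEST x. (x, 1) \<in> pos_sphere (dual_lattice F), 1) \<in> pos_sphere (dual_lattice F)"
  proof (rule compact_Greatest)
    have "closed {x. (x, 1) \<in> pos_sphere (dual_lattice F)}"
      unfolding dual_pos_sphere_iff[OF F]
      by (intro closed_Collect_conj closed_Collect_all closed_Collect_imp open_Collect_const
          closed_Collect_le continuous_intros)
    moreover have "{x. (x, 1) \<in> pos_sphere (dual_lattice F)} \<subseteq> {0..1}"
      unfolding dual_pos_sphere_iff[OF F]
    proof clarsimp
      fix x assume "\<forall>a1 a2. F (a1, a2) \<le> 1 \<longrightarrow> \<bar>x * a1 + a2\<bar> \<le> 1"
      from this[rule_format, of 1 0] e show "x \<le> 1" by simp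
    qed
    ultimately show "compact {x. (x, 1) \<in> pos_sphere (dual_lattice F)}"
      using compact_Icc compact_Int_closed by (metis inf.absorb_iff2)
    show "(0, 1) \<in> pos_sphere (dual_lattice F)"
      unfolding dual_pos_sphere_iff[OF F] using b by auto
  qed
qed

text \<open>The functional \<open>(x, 1)\<close> is at most 1 at \<open>v\<close> and takes the
  value \<open>x < 1\<close> at \<open>(1, 0)\<close>, so on the first edge it can equal 1 only at
  \<open>v\<close>. The functional \<open>(1, y)\<close> excludes the rest of the second edge in the
  same way.\<close>

lemma supporting_line_vertex:
  assumes F: "two_dim_lattice F"
    and S: "pos_sphere F = closed_segment (1, 0) v \<union> closed_segment v (0, 1)"
    and v: "v \<notin> closed_segment (1, 0) (0, 1)"
    and f: "(f1, f2) \<in> pos_sphere F"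
    and c: "(1, y) \<in> pos_sphere (dual_lattice F)" "(x, 1) \<in> pos_sphere (dual_lattice F)"
    and on_line: "f1 + f2 * y = 1" "f1 * x + f2 = 1"
  shows "(f1, f2) = v"
proof -
  obtain v1 v2 where v12: "v = (v1, v2)" by fastforce
  have e: "F (1, 0) = 1" "F (0, 1) = 1" using F by (auto simp: two_dim_lattice_def)
  have cd: "a1 + y * a2 \<le> 1" "x * a1 + a2 \<le> 1" if "F (a1, a2) \<le> 1" for a1 a2
    using c that unfolding dual_pos_sphere_iff[OF F] by (meson abs_le_D1)+
  have "v \<in> pos_sphere F" unfolding S by simp
  then have Fv: "F (v1, v2) = 1" "0 \<le> v1" "0 \<le> v2" by (auto simp: pos_sphere_def v12)
  have xy: "y \<le> 1" "x \<le> 1" using cd(1)[of 0 1] cd(2)[of 1 0] e by auto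
  \<comment> \<open>The vertex lies strictly beyond the chord, so \<open>v1 + v2 > 1\<close>; with
    \<open>x = 1\<close> or \<open>y = 1\<close> the functional would be the coordinate sum and
    exceed 1 at \<open>v\<close>.\<close>
  have not1: "y \<noteq> 1" "x \<noteq> 1"
  proof -
    have "v1 + v2 \<noteq> 1"
    proof
      assume "v1 + v2 = 1"
      then have "v = (1 - v2) *\<^sub>R (1, 0) + v2 *\<^sub>R (0, 1)" "v2 \<le> 1"
        using Fv by (auto simp: v12)
      then have "v \<in> closed_segment (1, 0) (0, 1)"
        using Fv(3) unfolding in_segment by blast
      with v show False ..
    qed
    moreover have "1 \<le> v1 + v2" using two_dim_lattice_bounds(3)[OF F, of v1 v2] Fv by simp
    ultimately have "1 < v1 + v2" by simp
    then show "y \<noteq> 1" "x \<noteq> 1" using cd[of v1 v2] Fv(1) by auto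
  qed
  from f consider "(f1, f2) \<in> closed_segment (1, 0) v" | "(f1, f2) \<in> closed_segment v (0, 1)"
    unfolding S by blast
  then show ?thesis
  proof cases
    case 1
    then obtain t where t: "0 \<le> t" "t \<le> 1" "f1 = (1 - t) + t * v1" "f2 = t * v2"
      by (auto simp: in_segment v12)
    have "(1 - t) * x + t * (x * v1 + v2) = 1"
      using on_line(2) unfolding t(3,4) by (simp add: algebra_simps)
    moreover have "t * (x * v1 + v2) \<le> t"
      using cd(2)[of v1 v2] Fv(1) t(1) by (simp add: mult_left_le)
    ultimately have "0 \<le> (1 - t) * (x - 1)" by (simp add: algebra_simps)
    with t(2) xy(2) not1(2) have "t = 1" by (auto simp: zero_le_mult_iff)
    then show ?thesis using t by (simp add: v12)
  next
    case 2
    then obtain t where t: "0 \<le> t" "t \<le> 1" "f1 = (1 - t) * v1" "f2 = (1 - t) * v2 + t"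
      by (auto simp: in_segment v12)
    have "(1 - t) * (v1 + y * v2) + t * y = 1"
      using on_line(1) unfolding t(3,4) by (simp add: algebra_simps)
    moreover have "(1 - t) * (v1 + y * v2) \<le> 1 - t"
      using cd(1)[of v1 v2] Fv(1) t(2) by (simp add: mult_left_le)
    ultimately have "0 \<le> t * (y - 1)" by (simp add: algebra_simps)
    with t(1) xy(1) not1(1) have "t = 0" by (auto simp: zero_le_mult_iff)
    then show ?thesis using t by (simp add: v12)
  qed
qed

section \<open>The Daugavet center\<close>

text \<open>The geometry of \<open>F\<close> near \<open>(f1, f2)\<close> enters through
  \<open>faces\<close>. The triangle inequality gives the upper bound; the work lies in
  \<open>1 + c \<le> ?L\<close>.\<close>

lemma daugavet_center_lattice_sum:
  fixes F :: "real \<times> real \<Rightarrow> real"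
  assumes X: "daugavet_property (norm :: 'a::banach \<Rightarrow> real)"
    and F: "two_dim_lattice F" and f: "(f1, f2) \<in> pos_sphere F"
    and faces: "\<And>y c. y \<in> pos_sphere F \<Longrightarrow> 0 \<le> c \<Longrightarrow> F ((f1, f2) + c *\<^sub>R y) = 1 + c"
  shows "daugavet_center norm (lattice_sum F norm norm) (\<lambda>x::'a. (f1 *\<^sub>R x, f2 *\<^sub>R x))"
proof -
  let ?N = "lattice_sum F norm norm :: 'a \<times> 'a \<Rightarrow> real"
  let ?G = "\<lambda>x::'a. (f1 *\<^sub>R x, f2 *\<^sub>R x)"
  have NB: "banach_norm ?N" by (rule banach_norm_lattice_sum[OF F])
  then have N: "is_norm ?N" by (simp add: banach_norm_def)
  have tri: "?N (a + b) \<le> ?N a + ?N b" and N_scale: "?N (r *\<^sub>R a) = \<bar>r\<bar> * ?N a" for a b r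
    using N unfolding is_norm_def by blast+
  have F_scale: "F (r * a, r * b) = \<bar>r\<bar> * F (a, b)" for r a b
    using F unfolding two_dim_lattice_def is_norm_def by (metis scaleR_Pair real_scaleR_def)
  have f': "F (f1, f2) = 1" "0 \<le> f1" "0 \<le> f2" using f by (auto simp: pos_sphere_def)
  have NG: "?N (?G x) = norm x" for x
    using F_scale[of "norm x" f1 f2] f' by (simp add: lattice_sum_def mult.commute)
  obtain u :: 'a where u: "norm u = 1" by (rule daugavet_property_nontrivial[OF X])
  have linG: "linear ?G" by (rule linearI) (auto simp: scaleR_add_right)
  have G: "bounded_linear_wrt norm ?N ?G"
    unfolding bounded_linear_wrt_def using linG NG by (auto intro!: exI[of _ 1])
  have opG: "op_norm norm ?N ?G = 1"
  proof (rule antisym)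
    show "op_norm norm ?N ?G \<le> 1" using NG by (intro op_norm_le) auto
    show "1 \<le> op_norm norm ?N ?G" using op_norm_bound[OF N G, of u] NG u by simp
  qed
  have "?G u \<noteq> 0"
  proof
    assume "?G u = 0"
    then have "?N (?G u) = 0" using N unfolding is_norm_def by blast
    with NG u show False by simp
  qed
  then have "?G \<noteq> (\<lambda>x. 0)" by metis
  moreover have "op_norm norm ?N (\<lambda>x. ?G x + T x) = op_norm norm ?N ?G + op_norm norm ?N T"
    if T: "bounded_linear_wrt norm ?N T" "rank_one T" for T :: "'a \<Rightarrow> 'a \<times> 'a"
  proof -
    define c where "c = op_norm norm ?N T"
    let ?L = "op_norm norm ?N (\<lambda>x. ?G x + T x)"
    have linT: "linear T" using T(1) by (simp add: bounded_linear_wrt_def)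
    obtain \<phi> w where \<phi>: "linear \<phi>" "?N w = 1" "\<And>x. T x = \<phi> x *\<^sub>R w"
      using rank_oneE[OF linT T(2) N] by blast
    have NT: "?N (T x) = \<bar>\<phi> x\<bar>" for x using \<phi>(2,3) N_scale by simp
    have \<phi>_le: "\<bar>\<phi> x\<bar> \<le> c * norm x" for x
      using op_norm_bound[OF N T(1), of x] NT by (simp add: c_def)
    have bl: "bounded_linear \<phi>"
      using \<phi>(1) \<phi>_le by (intro bounded_linear_intro[where K = c]) (auto simp: linear_add linear_scale mult.commute)
    have c_onorm: "onorm \<phi> = c"
      by (simp add: c_def op_norm_def onorm_def NT)
    have "\<exists>x. \<phi> x \<noteq> 0"
    proof (rule ccontr)
      assume "\<nexists>x. \<phi> x \<noteq> 0"
      then have "range T = {0}" using \<phi>(3) by auto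
      moreover have "dim {0::'a \<times> 'a} = 0"
        using dim_span[of "{}::('a \<times> 'a) set"] dim_eq_card_independent[OF independent_empty]
        by (metis card.empty span_empty)
      ultimately show False using T(2) by (simp add: rank_one_def)
    qed
    then have "c \<noteq> 0" using \<phi>_le by force
    then have cpos: "0 < c" using onorm_pos_le[OF bl] c_onorm by simp
    have le: "?N (?G x + T x) \<le> (1 + c) * norm x" for x
      using tri[of "?G x" "T x"] NG[of x] NT[of x] \<phi>_le[of x] by (simp add: algebra_simps)
    have GT: "bounded_linear_wrt norm ?N (\<lambda>x. ?G x + T x)"
      unfolding bounded_linear_wrt_def
      using linear_compose_add[OF linG linT] le by (auto intro!: exI[of _ "1 + c"] simp: mult.commute)
    have "?L \<le> 1 + c" using le cpos by (intro op_norm_le) auto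
    moreover have "1 + c \<le> ?L"
    proof -
      obtain w1 w2 where w: "w = (w1, w2)" by fastforce
      have wS: "(norm w1, norm w2) \<in> pos_sphere F"
        using \<phi>(2) by (simp add: pos_sphere_def w lattice_sum_def)
      \<comment> \<open>For \<open>z = 0\<close> the unit vector \<open>u\<close> serves, so a
        vanishing coordinate of \<open>w\<close> is no special case.\<close>
      have "\<exists>y. norm y = 1 \<and> z = norm z *\<^sub>R y" for z :: 'a
        using u by (cases "z = 0") (auto intro: exI[of _ "sgn z"] simp: norm_sgn sgn_div_norm)
      then obtain y1 y2 where y: "norm y1 = 1" "w1 = norm w1 *\<^sub>R y1" "norm y2 = 1" "w2 = norm w2 *\<^sub>R y2"
        by metis
      have bl': "bounded_linear (\<lambda>x. inverse c *\<^sub>R \<phi> x)" "onorm (\<lambda>x. inverse c *\<^sub>R \<phi> x) = 1"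
        using bl onorm_scaleR[OF bl, of "inverse c"] c_onorm cpos
        by (simp_all del: real_scaleR_def add: bounded_linear_const_scaleR)
      have approx: "(1 - 3 * e) * (1 + c) \<le> ?L" if e: "0 < e" "e \<le> 1 / 2" for e
      proof -
        obtain x where x: "norm x \<le> 1" "1 - e < inverse c *\<^sub>R \<phi> x"
          "2 - 2 * e < norm (x + y1)" "2 - 2 * e < norm (x + y2)"
          using daugavet_common_slice_point[OF X bl' y(1,3), of e] e by auto
        have \<phi>x: "(1 - e) * c \<le> \<phi> x" using x(2) cpos by (simp add: field_simps)
        moreover have "0 \<le> (1 - e) * c" using e cpos by simp
        ultimately have \<phi>0: "0 \<le> \<phi> x" by linarith
        \<comment> \<open>The factor \<open>1 - e\<close> is the loss in
          \<open>\<phi> x \<ge> (1 - e) * c\<close>, and \<open>1 - 2 * e\<close> is the loss from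
          \<open>norm_combination_ge\<close> with defect \<open>2 * e\<close>. The product is at
          least \<open>1 - 3 * e\<close>.\<close>
        define m where "m = (1 - 2 * e) * (1 - e)"
        have m: "0 \<le> m" using e by (simp add: m_def)
        have est: "m * (r + c * norm z) \<le> norm (r *\<^sub>R x + \<phi> x *\<^sub>R z)"
          if r: "0 \<le> r" and z: "norm y = 1" "z = norm z *\<^sub>R y" "2 - 2 * e < norm (x + y)" for r y z
        proof -
          have "(1 - e) * c * norm z \<le> \<phi> x * norm z"
            using \<phi>x by (rule mult_right_mono) simp
          moreover have "(1 - e) * r \<le> r" using r e by (intro mult_left_le_one_le) auto
          ultimately have "(1 - e) * (r + c * norm z) \<le> r + \<phi> x * norm z"
            by (simp add: distrib_left mult.assoc)
          then have "m * (r + c * norm z) \<le> (1 - 2 * e) * (r + \<phi> x * norm z)"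
            unfolding m_def mult.assoc using e by (intro mult_left_mono) auto
          also have "\<dots> \<le> norm (r *\<^sub>R x + (\<phi> x * norm z) *\<^sub>R y)"
            using x(1) z r \<phi>0 e by (intro norm_combination_ge) auto
          also have "(\<phi> x * norm z) *\<^sub>R y = \<phi> x *\<^sub>R z"
            using z(2) by (metis scaleR_scaleR)
          finally show ?thesis .
        qed
        have "(1 - 3 * e) * (1 + c) \<le> m * (1 + c)"
          using cpos by (intro mult_right_mono) (auto simp: m_def algebra_simps)
        also have "\<dots> = m * F (f1 + c * norm w1, f2 + c * norm w2)"
          using faces[OF wS, of c] cpos by simp
        also have "\<dots> = F (m * (f1 + c * norm w1), m * (f2 + c * norm w2))"
          using F_scale m by simp
        \<comment> \<open>The coordinatewise bounds \<open>est\<close> pass through \<open>F\<close>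
          because it is monotone on the positive quadrant.\<close>
        also have "\<dots> \<le> F (norm (f1 *\<^sub>R x + \<phi> x *\<^sub>R w1), norm (f2 *\<^sub>R x + \<phi> x *\<^sub>R w2))"
          using f' m cpos est[OF f'(2) y(1,2) x(3)] est[OF f'(3) y(3,4) x(4)]
          by (intro two_dim_lattice_mono[OF F]) auto
        also have "\<dots> = ?N (?G x + T x)" by (simp add: \<phi>(3) w lattice_sum_def)
        also have "\<dots> \<le> ?L * norm x" by (rule op_norm_bound[OF N GT])
        also have "\<dots> \<le> ?L"
        proof -
          have "0 \<le> ?N (?G u + T u)" using N unfolding is_norm_def by blast
          then have "0 \<le> ?L" using op_norm_bound[OF N GT, of u] u by simp
          then show ?thesis using x(1) by (simp add: mult_left_le)
        qed
        finally show ?thesis .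
      qed
      show ?thesis
      proof (rule ccontr)
        assume "\<not> 1 + c \<le> ?L"
        then have gap: "0 < 1 + c - ?L" by simp
        \<comment> \<open>This makes \<open>3 * e * (1 + c)\<close> at most half of the gap, whereas
          \<open>approx\<close> would require it to be at least the whole gap.\<close>
        define e where "e = min (1 / 2) ((1 + c - ?L) / (6 * (1 + c)))"
        have "e \<le> 1 / 2" unfolding e_def by (rule min.cobounded1)
        moreover have "0 < e" using gap cpos by (simp add: e_def)
        ultimately have e: "0 < e" "e \<le> 1 / 2" by simp_all
        have "e \<le> (1 + c - ?L) / (6 * (1 + c))" by (simp add: e_def)
        then have "e * (6 * (1 + c)) \<le> 1 + c - ?L"
          using cpos by (simp add: pos_le_divide_eq)
        then show False using approx[OF e] gap by (simp add: algebra_simps)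
      qed
    qed
    ultimately show ?thesis by (simp add: opG c_def)
  qed
  ultimately show ?thesis
    using NB G banach_norm_norm by (simp add: daugavet_center_def)
qed

theorem proposition6p6:
  fixes F :: "real \<times> real \<Rightarrow> real"
    and c1 c2 :: "real \<times> real"
    and f1 f2 :: real
    and G :: "'a::banach \<Rightarrow> 'a \<times> 'a"
  assumes X: "daugavet_property (norm :: 'a \<Rightarrow> real)"
    and F: "F \<in> polygonal_lattices 2 2 \<union> polygonal_lattices 3 2"
    and c1: "c1 = (1, GREATEST y. (1, y) \<in> pos_sphere (dual_lattice F))"
    and c2: "c2 = ((GREATEST x. (x, 1) \<in> pos_sphere (dual_lattice F)), 1)"
    and f: "(f1, f2) \<in> pos_sphere F"
    and line: "affine hull {c1, c2} = {(a1, a2). f1 * a1 + f2 * a2 = 1}"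
    and G: "G = (\<lambda>x. (f1 *\<^sub>R x, f2 *\<^sub>R x))"
  shows "daugavet_center norm (lattice_sum F norm norm) G"
proof -
  have L: "two_dim_lattice F" and "polygonal_arc (pos_sphere F) 2"
    using F by (auto simp: polygonal_lattices_def)
  then obtain v where v: "pos_sphere F = closed_segment (1, 0) v \<union> closed_segment v (0, 1)"
    "v \<notin> closed_segment (1, 0) (0, 1)"
    using polygonal_arc_2E by blast
  \<comment> \<open>Evaluating the equation of the line at \<open>c1\<close> and \<open>c2\<close>
    says that both functionals take the value 1 at \<open>(f1, f2)\<close>.\<close>
  have "c1 \<in> affine hull {c1, c2}" "c2 \<in> affine hull {c1, c2}" by (simp_all add: hull_inc)
  then have "f1 + f2 * snd c1 = 1" "f1 * fst c2 + f2 = 1"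
    unfolding line by (auto simp: c1 c2)
  then have "(f1, f2) = v"
    using dual_sphere_Greatest[OF L] by (intro supporting_line_vertex[OF L v f]) (auto simp: c1 c2)
  moreover have "is_norm F" using L by (simp add: two_dim_lattice_def)
  ultimately show ?thesis
    unfolding G using vertex_plus_sphere[OF _ v(1)]
    by (intro daugavet_center_lattice_sum[OF X L f]) auto
qed

end
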